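(* If $(\boldsymbol{a}_k)_k$ is a Galerkin sequence, then for all $k$ \[\inf_{P\in\mathcal{P}^\flat_{\boldsymbol{a}_k}}\operatorname{dist}_H(P,K)\le 2\,\delta_{\boldsymbol{a}_k}\,\|K\|\quad\text{for all}\ K\in\mathcal{K}^d.\]
   Context: Let $d\ge 2$. $\mathcal{K}^d$ is the space of all nonempty, convex and compact subsets of $\mathbb{R}^d$; $\operatorname{dist}_H$ is the Hausdorff distance with respect to the Euclidean norm; $\|K\|:=\max_{x\in K}\|x\|$. For a tuple $\boldsymbol{a}=(a_1,\ldots,a_N)\in\mathbb{R}^{d\times N}$ of pairwise distinct Euclidean unit vectors, define $\mathcal{C}^\flat_{\boldsymbol{a}}:=\{\boldsymbol{x}=(x_1,\ldots,x_N)\in\mathbb{R}^{d\times N}: a_i^Tx_j\le a_i^Tx_i\ \text{for all}\ i\ne j\}$, $\mathcal{P}^\flat_{\boldsymbol{a}}:=\{\operatorname{conv}\{x_1,\ldots,x_N\}:\boldsymbol{x}\in\mathcal{C}^\flat_{\boldsymbol{a}}\}$, and the chordal covering radius $\delta_{\boldsymbol{a}}:=\max_{u\in S^{d-1}}\min_{i\in\{1,\ldots,N\}}\|u-a_i\|$. Galerkin sequence: let $(N_k)_k$ be a strictly increasing sequence of positive integers, and for each $k$ let $\boldsymbol{a}_k=([\boldsymbol{a}_k]_1,\ldots,[\boldsymbol{a}_k]_{N_k})\in\mathbb{R}^{d\times N_k}$ with $\|[\boldsymbol{a}_k]_i\|=1$ for all $i$ and $[\boldsymbol{a}_k]_i\ne[\boldsymbol{a}_k]_j$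 for $i\ne j$. Then $(\boldsymbol{a}_k)_k$ is called a Galerkin sequence if $\lim_{k\to\infty}\delta_{\boldsymbol{a}_k}=0$. *)

theory Defs
  imports "HOL-Analysis.Analysis"
begin

text \<open>
  The space \<open>real ^ 'd\<close> carries the Euclidean norm.  An \<open>N\<close>-tuple of vectors is a function
  on \<open>{1..N}\<close>; elements of \<open>coord_set\<close> are undefined elsewhere, so that they
  correspond exactly to tuples.
\<close>

definition convex_bodies :: "(real ^ 'd) set set" where
  "convex_bodies = {K. K \<noteq> {} \<and> convex K \<and> compact K}"

text \<open>Intended for nonempty bounded sets, where both suprema are taken over bounded sets.\<close>

definition hausdorff_dist :: "(real ^ 'd) set \<Rightarrow> (real ^ 'd) set \<Rightarrow> real" where
  "hausdorff_dist A B = max (SUP x\<in>A. infdist x B) (SUP y\<in>B. infdist y A)"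

definition set_norm :: "(real ^ 'd) set \<Rightarrow> real" where
  "set_norm K = (SUP x\<in>K. norm x)"

definition coord_set :: "nat \<Rightarrow> (nat \<Rightarrow> real ^ 'd) \<Rightarrow> (nat \<Rightarrow> real ^ 'd) set" where
  "coord_set N a =
    {x \<in> {1..N} \<rightarrow>\<^sub>E UNIV. \<forall>i\<in>{1..N}. \<forall>j\<in>{1..N}. i \<noteq> j \<longrightarrow> a i \<bullet> x j \<le> a i \<bullet> x i}"

definition polytopes :: "nat \<Rightarrow> (nat \<Rightarrow> real ^ 'd) \<Rightarrow> (real ^ 'd) set set" where
  "polytopes N a = (\<lambda>x. convex hull (x ` {1..N})) ` coord_set N a"

definition covering_radius :: "nat \<Rightarrow> (nat \<Rightarrow> real ^ 'd) \<Rightarrow> real" where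
  "covering_radius N a = (SUP u\<in>sphere 0 1. MIN i\<in>{1..N}. norm (u - a i))"

definition galerkin_sequence :: "(nat \<Rightarrow> nat) \<Rightarrow> (nat \<Rightarrow> nat \<Rightarrow> real ^ 'd) \<Rightarrow> bool" where
  "galerkin_sequence N a \<longleftrightarrow>
    strict_mono N \<and> (\<forall>k. 0 < N k) \<and>
    (\<forall>k. \<forall>i\<in>{1..N k}. norm (a k i) = 1) \<and>
    (\<forall>k. inj_on (a k) {1..N k}) \<and>
    (\<lambda>k. covering_radius (N k) (a k)) \<longlonglongrightarrow> 0"

text \<open>The suprema in \<open>set_norm\<close> and \<open>covering_radius\<close> are attained, that is, maxima.\<close>

lemma SUP_attained:
  fixes f :: "'a::topological_space \<Rightarrow> real"
  assumes "compact S" "S \<noteq> {}" "continuous_on S f"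
  shows "(\<exists>x\<in>S. f x = (SUP x\<in>S. f x)) \<and> (\<forall>x\<in>S. f x \<le> (SUP x\<in>S. f x))"
proof -
  obtain x where x: "x \<in> S" "\<And>y. y \<in> S \<Longrightarrow> f y \<le> f x"
    using continuous_attains_sup[OF assms] by auto
  have "(SUP x\<in>S. f x) = f x"
    using x by (intro cSup_eq_maximum) auto
  then show ?thesis using x by auto
qed

lemma set_norm_attained:
  assumes "K \<in> convex_bodies"
  shows "(\<exists>x\<in>K. norm x = set_norm K) \<and> (\<forall>x\<in>K. norm x \<le> set_norm K)"
  unfolding set_norm_def using assms
  by (intro SUP_attained continuous_intros) (auto simp: convex_bodies_def)

lemma continuous_on_MIN:
  fixes f :: "'i \<Rightarrow> 'a::topological_space \<Rightarrow> real"
  assumes "finite I" "I \<noteq> {}" "\<And>i. i \<in> I \<Longrightarrow> continuous_on S (f i)"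
  shows "continuous_on S (\<lambda>u. MIN i\<in>I. f i u)"
  using assms
proof (induction rule: finite_ne_induct)
  case (insert i I)
  then show ?case by (auto intro!: continuous_on_min)
qed auto

lemma covering_radius_attained:
  assumes "0 < N"
  shows "(\<exists>u\<in>sphere 0 1. (MIN i\<in>{1..N}. norm (u - a i)) = covering_radius N a) \<and>
    (\<forall>u\<in>sphere 0 1. (MIN i\<in>{1..N}. norm (u - a i)) \<le> covering_radius N a)"
  unfolding covering_radius_def using assms
  by (intro SUP_attained continuous_on_MIN continuous_intros) auto

end

theory Submission
  imports Defs
begin

text \<open>
  Choose \<open>x\<^sub>i \<in> K\<close> maximising \<open>a\<^sub>i \<bullet> _\<close> over \<open>K\<close> and let \<open>P \<subseteq> K\<close> be the convex hull of these points.
  If \<open>p\<close> is the projection of \<open>y \<in> K\<close> onto \<open>P\<close>, \<open>u\<close> is the unit direction of \<open>y - p\<close>, and \<open>a\<^sub>i\<close> is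
  within \<open>\<delta>\<close> of \<open>u\<close>, then
  \<open>\<parallel>y - p\<parallel> = u \<bullet> (y - p) \<le> u \<bullet> (y - x\<^sub>i) \<le> (u - a\<^sub>i) \<bullet> (y - x\<^sub>i) \<le> \<delta> \<parallel>y - x\<^sub>i\<parallel> \<le> 2 \<delta> \<parallel>K\<parallel>\<close>:
  the first inequality is the variational characterisation of \<open>p\<close>, the second the choice of \<open>x\<^sub>i\<close>.
\<close>

text \<open>Asking for \<open>support\<close> in every unit direction keeps the projection of
  \<open>y\<close> out of the applications. The bound \<open>0 \<le> r\<close> settles the case of
  \<open>y\<close> inside \<open>P\<close>.\<close>

lemma infdist_le_direction:
  fixes y :: "'a::euclidean_space"
  assumes "closed P" "convex P" "P \<noteq> {}" "0 \<le> r"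
    and support: "\<And>u. norm u = 1 \<Longrightarrow> \<exists>x\<in>P. u \<bullet> (y - x) \<le> r"
  shows "infdist y P \<le> r"
proof (cases "y \<in> P")
  case True
  then show ?thesis using \<open>0 \<le> r\<close> by simp
next
  case False
  define p where "p = closest_point P y"
  have p: "p \<in> P"
    unfolding p_def using assms(1,3) by (rule closest_point_in_set)
  with False have pos: "norm (y - p) > 0" by auto
  define u where "u = (y - p) /\<^sub>R norm (y - p)"
  have "norm u = 1" using pos by (simp add: u_def)
  then obtain x where x: "x \<in> P" "u \<bullet> (y - x) \<le> r" using support by blast
  have "(y - p) \<bullet> (x - p) \<le> 0"
    unfolding p_def using assms(1,2) x(1) by (intro closest_point_dot)
  then have "u \<bullet> (x - p) \<le> 0"
    using pos by (simp add: u_def divide_simps mult_le_0_iff)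
  moreover have "u \<bullet> (y - p) = norm (y - p)"
    using pos by (simp add: u_def flip: power2_norm_eq_inner) (simp add: power2_eq_square)
  moreover have "infdist y P \<le> norm (y - p)"
    using infdist_le[OF p, of y] by (simp add: dist_norm)
  \<comment> \<open>Split \<open>u \<bullet> (y - p)\<close> as
    \<open>u \<bullet> (y - x) + u \<bullet> (x - p)\<close>.\<close>
  ultimately show ?thesis using x(2) by (simp add: inner_diff_right)
qed

text \<open>Compactness of \<open>A\<close> makes the first supremum a value of
  \<open>infdist\<close>, which is nonnegative.\<close>

lemma hausdorff_dist_nonneg:
  assumes "compact A" "A \<noteq> {}"
  shows "0 \<le> hausdorff_dist A B"
proof -
  have "\<exists>x\<in>A. infdist x B = (SUP x\<in>A. infdist x B)"
    using SUP_attained[of A "\<lambda>x. infdist x B"] assms by (simp add: continuous_intros)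
  then have "0 \<le> (SUP x\<in>A. infdist x B)"
    using infdist_nonneg by metis
  then show ?thesis by (simp add: hausdorff_dist_def)
qed

text \<open>Points of \<open>A\<close> have distance 0 to \<open>B\<close>, so only the supremum
  over \<open>B\<close> matters.\<close>

lemma hausdorff_dist_subset_le:
  assumes "A \<subseteq> B" "A \<noteq> {}" "0 \<le> r" "\<And>y. y \<in> B \<Longrightarrow> infdist y A \<le> r"
  shows "hausdorff_dist A B \<le> r"
  unfolding hausdorff_dist_def
proof (rule max.boundedI)
  show "(SUP x\<in>A. infdist x B) \<le> r"
    using assms by (intro cSUP_least) auto
  show "(SUP y\<in>B. infdist y A) \<le> r"
    using assms by (intro cSUP_least) auto
qed

lemma covering_radius_near:
  assumes "0 < N" "norm u = 1"
  obtains i where "i \<in> {1..N}" "norm (u - a i) \<le> covering_radius N a"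
proof -
  have "(MIN i\<in>{1..N}. norm (u - a i)) \<in> (\<lambda>i. norm (u - a i)) ` {1..N}"
    using assms(1) by (intro Min_in) auto
  moreover have "(MIN i\<in>{1..N}. norm (u - a i)) \<le> covering_radius N a"
    using covering_radius_attained[OF assms(1), of a] assms(2) by simp
  ultimately show ?thesis using that by force
qed

lemma covering_radius_nonneg:
  fixes a :: "nat \<Rightarrow> real ^ 'd"
  assumes "0 < N"
  shows "0 \<le> covering_radius N a"
proof -
  obtain u :: "real ^ 'd" where "norm u = 1"
    using vector_choose_size[of 1] by auto
  with assms obtain i where "norm (u - a i) \<le> covering_radius N a"
    using covering_radius_near by metis
  then show ?thesis using norm_ge_zero order_trans by blast
qed

lemma polytope_approximation:
  fixes a :: "nat \<Rightarrow> real ^ 'd"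
  assumes "0 < N" "K \<in> convex_bodies"
  obtains P where "P \<in> polytopes N a"
    "hausdorff_dist P K \<le> 2 * covering_radius N a * set_norm K"
proof -
  have K: "K \<noteq> {}" "convex K" "compact K"
    using assms(2) by (auto simp: convex_bodies_def)
  have norm_le: "norm y \<le> set_norm K" if "y \<in> K" for y
    using set_norm_attained[OF assms(2)] that by blast
  have "\<exists>x\<in>K. \<forall>y\<in>K. a i \<bullet> y \<le> a i \<bullet> x" for i
    using K by (intro continuous_attains_sup continuous_intros)
  then obtain f where f: "\<And>i. f i \<in> K" "\<And>i y. y \<in> K \<Longrightarrow> a i \<bullet> y \<le> a i \<bullet> f i"
    by metis
  \<comment> \<open>Members of \<open>coord_set\<close> are extensional, hence the
    restriction.\<close>
  define x where "x = restrict f {1..N}"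
  define P where "P = convex hull (x ` {1..N})"
  define r where "r = 2 * covering_radius N a * set_norm K"
  \<comment> \<open>Each \<open>x j\<close> lies in \<open>K\<close>, where \<open>x i\<close>
    maximises the functional of \<open>a i\<close>.\<close>
  have "x \<in> coord_set N a"
    using f by (auto simp: coord_set_def x_def)
  then have "P \<in> polytopes N a"
    by (auto simp: polytopes_def P_def)
  moreover have "hausdorff_dist P K \<le> r"
  proof (rule hausdorff_dist_subset_le)
    show "P \<subseteq> K"
      unfolding P_def using f K by (intro hull_minimal) (auto simp: x_def)
    show P: "P \<noteq> {}"
      using assms(1) by (simp add: P_def)
    obtain z where "z \<in> K" using K(1) by blast
    then have "0 \<le> set_norm K"
      using norm_le norm_ge_zero order_trans by blast
    then show r: "0 \<le> r"
      using covering_radius_nonneg[OF assms(1), of a] by (simp add: r_def)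
    fix y assume y: "y \<in> K"
    show "infdist y P \<le> r"
    proof (rule infdist_le_direction)
      show "closed P" "convex P"
        by (simp_all add: P_def compact_imp_closed finite_imp_compact_convex_hull)
      fix u :: "real ^ 'd" assume "norm u = 1"
      with assms(1) obtain i where i: "i \<in> {1..N}" "norm (u - a i) \<le> covering_radius N a"
        by (rule covering_radius_near)
      have "u \<bullet> (y - f i) \<le> (u - a i) \<bullet> (y - f i)"
        using f(2)[OF y, of i] by (simp add: inner_diff_left inner_diff_right)
      also have "\<dots> \<le> norm (u - a i) * norm (y - f i)"
        by (rule norm_cauchy_schwarz)
      \<comment> \<open>The factor 2 arises because \<open>y\<close> and \<open>f i\<close> both lie
        in \<open>K\<close>, so each has norm at most \<open>set_norm K\<close>.\<close>
      also have "\<dots> \<le> covering_radius N a * (2 * set_norm K)"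
        using i(2) norm_triangle_ineq4[of y "f i"] norm_le[OF y] norm_le[OF f(1), of i]
          covering_radius_nonneg[OF assms(1)]
        by (intro mult_mono) auto
      finally have "u \<bullet> (y - f i) \<le> r" by (simp add: r_def mult_ac)
      moreover have "f i \<in> P"
        unfolding P_def using i(1) by (intro hull_inc) (auto simp: x_def)
      ultimately show "\<exists>x\<in>P. u \<bullet> (y - x) \<le> r" by blast
    qed (use P r in auto)
  qed
  ultimately show ?thesis using that by (simp add: r_def)
qed

theorem corollary37:
  fixes N :: "nat \<Rightarrow> nat" and a :: "nat \<Rightarrow> nat \<Rightarrow> real ^ 'd"
  assumes "CARD('d) \<ge> 2"
    and "galerkin_sequence N a"
  shows "\<forall>k. \<forall>K\<in>convex_bodies.
    (INF P\<in>polytopes (N k) (a k). hausdorff_dist P K)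
      \<le> 2 * covering_radius (N k) (a k) * set_norm K"
proof (intro allI ballI)
  fix k and K :: "(real ^ 'd) set" assume K: "K \<in> convex_bodies"
  have N: "0 < N k" using assms(2) by (simp add: galerkin_sequence_def)
  obtain P where P: "P \<in> polytopes (N k) (a k)"
    "hausdorff_dist P K \<le> 2 * covering_radius (N k) (a k) * set_norm K"
    using polytope_approximation[OF N K] .
  \<comment> \<open>A real \<open>INF\<close> is sure to lie below its members only when these are
    bounded below; 0 is such a bound.\<close>
  have "0 \<le> hausdorff_dist Q K" if "Q \<in> polytopes (N k) (a k)" for Q
    using that N
    by (intro hausdorff_dist_nonneg) (auto simp: polytopes_def finite_imp_compact_convex_hull)
  then have "bdd_below ((\<lambda>Q. hausdorff_dist Q K) ` polytopes (N k) (a k))"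
    by (intro bdd_belowI2)
  with P show "(INF P\<in>polytopes (N k) (a k). hausdorff_dist P K)
      \<le> 2 * covering_radius (N k) (a k) * set_norm K"
    by (meson cINF_lower order_trans)
qed

end
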